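(* Let $\mathcal H$ be a real Hilbert space with norm $\|\cdot\|$. Let $\alpha,\gamma,\rho,\kappa\in\left]0,+\infty\right[$, let $q\in\left]1,+\infty\right[$, set $q^*=q/(q-1)$, and let $C=\{y\in\mathcal H\mid\|y\|\leq\rho\}$. Define $\varphi\colon\mathcal H\to\mathbb R$ by $$\varphi=\alpha+\kappa\|\cdot\|+\frac{d_C^q}{q\rho^{q-1}},$$ where $d_C$ is the distance function to $C$, and let $\sigma\in\mathbb R$ and $x\in\mathcal H$. Then $$\widetilde\varphi(\sigma,x)=\begin{cases}\alpha\sigma+\kappa\|x\|+\dfrac{\sigma}{q\rho^{q-1}}\Big(\dfrac{\|x\|}{\sigma}-\rho\Big)^q,&\text{if }\sigma>0\text{ and }\|x\|>\rho\sigma;\\[2mm] \alpha\sigma+\kappa\|x\|,&\text{if }\sigma>0\text{ and }\|x\|\leq\rho\sigma;\\ 0,&\text{if }\sigma=0\text{ and }x=0;\\ +\infty,&\text{otherwise.}\end{cases}$$ Furthermore, set $\Delta\colon\mathbb R\to\mathbb R\colon\mu\mapsto\max(|\mu|-\kappa,0)+\big(\max(|\mu|-\kappa,0)\big)^{q^*}/q^*$. Then the following hold: (i) Suppose that $\Delta(\|x\|/\gamma)\leq(\alpha-\sigma/\gamma)/\rho$. Then $\operatorname{prox}_{\gamma\widetilde\varphi}(\sigma,x)=(0,0)$. (ii) Suppose that $\Delta(\|x\|/\gamma)>(\alpha-\sigma/\gamma)/\rho$ and that $\|x\|>\gamma\kappa+\rho(\sigma-\gamma\alpha)$. If $x\neq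 0$, let $t$ be the unique solution in $\left]\kappa,+\infty\right[$ to the equation $$\rho\bigg(\sigma-\gamma\alpha+\gamma\rho\Big(t-\kappa+\frac{(t-\kappa)^{q^*}}{q^*}\Big)\bigg)\Big(1+(t-\kappa)^{q^*-1}\Big)+\gamma t-\|x\|=0$$ (in particular, such a solution exists and is unique). Set $p=tx/\|x\|$ if $x\neq 0$, and set $t=0$ and $p=0$ if $x=0$. Then $\operatorname{prox}_{\gamma\widetilde\varphi}(\sigma,x)=\big(\sigma-\gamma\alpha+\gamma\rho\Delta(t),\,x-\gamma p\big)$. (iii) Suppose that $\gamma\kappa\leq\|x\|\leq\gamma\kappa+\rho(\sigma-\gamma\alpha)$. Then $\operatorname{prox}_{\gamma\widetilde\varphi}(\sigma,x)=\big(\sigma-\gamma\alpha,(1-\gamma\kappa/\|x\|)x\big)$. (iv) Suppose that $\sigma>\gamma\alpha$ and $\|x\|<\gamma\kappa$. Then $\operatorname{prox}_{\gamma\widetilde\varphi}(\sigma,x)=(\sigma-\gamma\alpha,0)$.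
   Context: For a real Hilbert space $\mathcal H$, $\Gamma_0(\mathcal H)$ is the class of proper lower semicontinuous convex functions from $\mathcal H$ to $\left]-\infty,+\infty\right]$. For $\varphi\in\Gamma_0(\mathcal H)$: the recession function is $(\operatorname{rec}\varphi)(x)=\sup_{y\in\operatorname{dom}\varphi}(\varphi(x+y)-\varphi(y))$; the perspective of $\varphi$ is $\widetilde\varphi\colon\mathbb R\times\mathcal H\to\left]-\infty,+\infty\right]$ defined by $\widetilde\varphi(\sigma,x)=\sigma\varphi(x/\sigma)$ if $\sigma>0$, $\widetilde\varphi(0,x)=(\operatorname{rec}\varphi)(x)$, and $\widetilde\varphi(\sigma,x)=+\infty$ if $\sigma<0$. The distance function is $d_C(x)=\inf_{y\in C}\|y-x\|$. The space $\mathbb R\oplus\mathcal H$ is the Hilbert direct sum, with $\langle(\sigma,x)\mid(\tau,y)\rangle=\sigma\tau+\langle x\mid y\rangle$. For $f\in\Gamma_0(\mathcal K)$ with $\mathcal K$ a real Hilbert space, $\operatorname{prox}_f(z)$ is the unique minimizer over $y\in\mathcal K$ of $f(y)+\frac12\|z-y\|^2$; $\operatorname{prox}_{\gamma\widetilde\varphi}$ is taken in $\mathbb R\oplus\mathcal H$. *)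

theory Defs
  imports "HOL-Analysis.Analysis"
begin

definition eff_dom :: "('a \<Rightarrow> ereal) \<Rightarrow> 'a set" where
  "eff_dom f = {y. f y < \<infinity>}"

definition recession :: "('a::real_vector \<Rightarrow> ereal) \<Rightarrow> 'a \<Rightarrow> ereal" where
  "recession f x = (SUP y\<in>eff_dom f. f (x + y) - f y)"

definition perspective :: "('a::real_vector \<Rightarrow> ereal) \<Rightarrow> real \<times> 'a \<Rightarrow> ereal" where
  "perspective f = (\<lambda>(\<sigma>, x).
     if \<sigma> > 0 then ereal \<sigma> * f (x /\<^sub>R \<sigma>)
     else if \<sigma> = 0 then recession f x
     else \<infinity>)"

definition prox_minimizer :: "('a::real_inner \<Rightarrow> ereal) \<Rightarrow> 'a \<Rightarrow> 'a \<Rightarrow> bool" where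
  "prox_minimizer f z p \<longleftrightarrow>
     is_arg_min (\<lambda>y. f y + ereal ((norm (z - y))\<^sup>2 / 2)) (\<lambda>_. True) p"

(* Meaningful only when the minimizer exists and is unique, as it does for every
   proper lower semicontinuous convex f on a Hilbert space. *)
definition prox :: "('a::real_inner \<Rightarrow> ereal) \<Rightarrow> 'a \<Rightarrow> 'a" where
  "prox f z = (THE p. prox_minimizer f z p)"

end

theory Submission imports Defs begin

text \<open>The conjugate of \<open>\<phi>\<close> is \<open>\<rho> \<Delta>(\<parallel>\<cdot>\<parallel>) - \<alpha>\<close>, so the perspective of \<open>\<phi>\<close> is the support
  function of the set of all \<open>(a, b)\<close> with \<open>a + \<rho> \<Delta>(\<parallel>b\<parallel>) \<le> \<alpha>\<close>; that it majorizes each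
  \<open>\<langle>(a, b) | \<cdot>\<rangle>\<close> is Young's inequality. A point \<open>p\<close> is therefore the (unique) proximal point
  of \<open>z\<close> as soon as \<open>(z - p) / \<gamma>\<close> lies in that set and attains the perspective at \<open>p\<close>. In each
  of the four regions the proposed point passes this test.\<close>

section \<open>Proximal points from subgradient inequalities\<close>

text \<open>Completing the square: expanding \<open>z - y\<close> around \<open>p\<close> turns the
  subgradient inequality into a lower bound for the objective that exceeds its value at
  \<open>p\<close> by \<open>(norm (y - p))\<^sup>2 / 2\<close>. This excess gives both minimality
  and uniqueness.\<close>

lemma prox_minimizer_iff_subgradient:
  fixes f :: "'a::real_inner \<Rightarrow> ereal"
  assumes fp: "f p = ereal c"
    and sub: "\<And>w. ereal (c + (z - p) \<bullet> (w - p)) \<le> f w"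
  shows "prox_minimizer f z w \<longleftrightarrow> w = p"
proof -
  define F where "F = (\<lambda>y. f y + ereal ((norm (z - y))\<^sup>2 / 2))"
  have Fp: "F p = ereal (c + (norm (z - p))\<^sup>2 / 2)"
    by (simp add: F_def fp)
  have ge: "ereal (c + (norm (z - p))\<^sup>2 / 2 + (norm (y - p))\<^sup>2 / 2) \<le> F y" for y
  proof -
    have "c + (norm (z - p))\<^sup>2 / 2 + (norm (y - p))\<^sup>2 / 2
        = c + (z - p) \<bullet> (y - p) + (norm (z - y))\<^sup>2 / 2"
      unfolding power2_norm_eq_inner
      by (simp add: inner_diff_left inner_diff_right inner_commute field_simps)
    then show ?thesis
      using add_right_mono[OF sub[of y], of "ereal ((norm (z - y))\<^sup>2 / 2)"]
      by (simp only: F_def plus_ereal.simps)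
  qed
  have min: "F p \<le> F y" for y
    using ge[of y] unfolding Fp by (rule order_trans[rotated]) simp
  have strict: "F p < F y" if "y \<noteq> p" for y
    using ge[of y] unfolding Fp by (rule less_le_trans[rotated]) (use that in simp)
  have "is_arg_min F (\<lambda>_. True) w \<longleftrightarrow> w = p"
    unfolding is_arg_min_def using min strict by (metis not_less)
  then show ?thesis
    by (simp add: prox_minimizer_def F_def)
qed

lemma prox_eqI_subgradient:
  fixes f :: "'a::real_inner \<Rightarrow> ereal"
  assumes "f p = ereal c"
    and "\<And>w. ereal (c + (z - p) \<bullet> (w - p)) \<le> f w"
  shows "(\<exists>!w. prox_minimizer f z w) \<and> prox f z = p"
  by (simp add: prox_def prox_minimizer_iff_subgradient[OF assms])

lemma infdist_cball_zero:
  fixes y :: "'a::real_normed_vector"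
  assumes "\<rho> \<ge> 0"
  shows "infdist y {y. norm y \<le> \<rho>} = max (norm y - \<rho>) 0"
proof (cases "norm y \<le> \<rho>")
  case True
  then show ?thesis by simp
next
  case False
  \<comment> \<open>The radial projection of \<open>y\<close> onto the ball, which attains the
    distance.\<close>
  define p where "p = (\<rho> / norm y) *\<^sub>R y"
  have y: "norm y > 0" using False assms by linarith
  have np: "norm p = \<rho>" using y assms by (simp add: p_def)
  have "y - p = ((norm y - \<rho>) / norm y) *\<^sub>R y"
    using y by (simp add: p_def diff_divide_distrib scaleR_left_diff_distrib)
  then have "dist y p = norm y - \<rho>"
    using y False by (simp add: dist_norm)
  then have le: "infdist y {y. norm y \<le> \<rho>} \<le> norm y - \<rho>"
    using np by (intro infdist_le2[of p]) auto
  have "norm y - \<rho> \<le> dist y a" if "norm a \<le> \<rho>" for a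
    using that norm_triangle_ineq2[of y a] by (simp add: dist_norm)
  then have "norm y - \<rho> \<le> infdist y {y. norm y \<le> \<rho>}"
    using np by (subst infdist_notempty) (auto intro!: cINF_greatest)
  with le False show ?thesis by simp
qed

section \<open>The function, the radial profile of its conjugate, and the exponents\<close>

locale ball_distance_perspective =
  fixes \<alpha> \<rho> \<kappa> q q' :: real
    and \<phi> :: "'a::real_inner \<Rightarrow> real"
    and \<Delta> :: "real \<Rightarrow> real"
  assumes pos: "\<alpha> > 0" "\<rho> > 0" "\<kappa> > 0" "q > 1"
    and q': "q' = q / (q - 1)"
    and phi: "\<phi> = (\<lambda>y. \<alpha> + \<kappa> * norm y
        + infdist y {y. norm y \<le> \<rho>} powr q / (q * \<rho> powr (q - 1)))"
    and Delta: "\<Delta> = (\<lambda>\<mu>. max (\<bar>\<mu>\<bar> - \<kappa>) 0 + (max (\<bar>\<mu>\<bar> - \<kappa>) 0) powr q' / q')"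
begin

lemma conj_exponent: "q' > 1" "1 / q + 1 / q' = 1" "(q' - 1) * q = q'"
  using pos by (auto simp: q' field_simps)

lemma phi_eq: "\<phi> y = \<alpha> + \<kappa> * norm y + max (norm y - \<rho>) 0 powr q / (q * \<rho> powr (q - 1))"
  using pos by (simp add: phi infdist_cball_zero)

lemma Delta_nonneg: "\<Delta> \<mu> \<ge> 0"
  using conj_exponent(1) by (simp add: Delta)

lemma Delta_mono: "\<bar>\<mu>\<bar> \<le> \<bar>\<nu>\<bar> \<Longrightarrow> \<Delta> \<mu> \<le> \<Delta> \<nu>"
  unfolding Delta using conj_exponent(1)
  by (intro add_mono divide_right_mono powr_mono2) auto

lemma Delta_eq_0: "\<bar>\<mu>\<bar> \<le> \<kappa> \<Longrightarrow> \<Delta> \<mu> = 0"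
  by (simp add: Delta)

lemma Delta_above: "\<mu> > \<kappa> \<Longrightarrow> \<Delta> \<mu> = \<mu> - \<kappa> + (\<mu> - \<kappa>) powr q' / q'"
  using pos by (simp add: Delta)

lemma eff_dom_phi: "eff_dom (\<lambda>y. ereal (\<phi> y)) = UNIV"
  by (simp add: eff_dom_def)

section \<open>The recession function and the explicit perspective\<close>

text \<open>Superlinear growth: along the ray of \<open>x\<close>, starting at distance
  \<open>h\<close> from the ball, a step of length \<open>norm x\<close> raises the
  \<open>q\<close>-th power of that distance by at least \<open>norm x * h powr (q - 1)\<close>,
  which is unbounded in \<open>h\<close> since \<open>q > 1\<close>.\<close>

lemma recession_phi_nonzero:
  assumes "x \<noteq> 0"
  shows "recession (\<lambda>y. ereal (\<phi> y)) x = \<infinity>"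
proof -
  let ?c = "q * \<rho> powr (q - 1)" and ?r = "norm x"
  have r: "?r > 0" and c: "?c > 0" using assms pos by auto
  have "\<exists>y\<in>UNIV. ereal B < ereal (\<phi> (x + y)) - ereal (\<phi> y)" for B
  proof -
    \<comment> \<open>\<open>K\<close> is the value of \<open>h powr (q - 1)\<close> for which this
      lower bound, divided by \<open>?c\<close>, equals \<open>\<bar>B\<bar>\<close>. The remaining
      increase \<open>\<kappa> * ?r\<close> makes the final inequality strict.\<close>
    define K where "K = \<bar>B\<bar> * ?c / ?r"
    define h where "h = K powr (1 / (q - 1))"
    define y where "y = ((h + \<rho>) / ?r) *\<^sub>R x"
    have K: "K \<ge> 0" using r c by (simp add: K_def)
    have h: "h \<ge> 0" by (simp add: h_def)
    have hK: "h powr (q - 1) = K" using K pos by (simp add: h_def powr_powr)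
    have ny: "norm y = h + \<rho>" using r h pos by (simp add: y_def)
    have "x + y = (1 + (h + \<rho>) / ?r) *\<^sub>R x"
      by (simp add: y_def scaleR_left_distrib)
    then have "norm (x + y) = (1 + (h + \<rho>) / ?r) * ?r"
      using r h pos by simp
    then have nxy: "norm (x + y) = ?r + h + \<rho>"
      using r by (simp only: distrib_right) simp
    have split: "u powr q = u * u powr (q - 1)" if "u \<ge> 0" for u :: real
      using that pos by (cases "u = 0") (auto simp: powr_mult_base)
    have "?r * h powr (q - 1) + h powr q = (?r + h) * h powr (q - 1)"
      using split[OF h] by (simp add: algebra_simps)
    also have "\<dots> \<le> (?r + h) * (?r + h) powr (q - 1)"
      using r h pos by (intro mult_left_mono powr_mono2) auto
    also have "\<dots> = (?r + h) powr q"
      using r h by (simp add: split)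
    finally have "?r * K \<le> (?r + h) powr q - h powr q"
      by (simp add: hK)
    then have "?r * K / ?c \<le> ((?r + h) powr q - h powr q) / ?c"
      using c by (intro divide_right_mono) auto
    moreover have "?r * K / ?c = \<bar>B\<bar>"
      using r pos by (simp add: K_def)
    moreover have "\<phi> (x + y) - \<phi> y = \<kappa> * ?r + ((?r + h) powr q - h powr q) / ?c"
      using r h by (simp add: phi_eq nxy ny algebra_simps diff_divide_distrib)
    moreover have "\<kappa> * ?r > 0" using pos r by simp
    ultimately have "B < \<phi> (x + y) - \<phi> y" by linarith
    then show ?thesis by (intro bexI[of _ y]) auto
  qed
  then show ?thesis
    unfolding recession_def eff_dom_phi
    by (intro ereal_top) (metis SUP_upper order_trans less_imp_le)
qed

lemma recession_phi_zero: "recession (\<lambda>y. ereal (\<phi> y)) 0 = 0"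
  by (simp add: recession_def eff_dom_phi)

lemma perspective_phi:
  "perspective (\<lambda>y. ereal (\<phi> y)) (\<sigma>, x) =
     (if \<sigma> > 0 \<and> norm x > \<rho> * \<sigma> then
        ereal (\<alpha> * \<sigma> + \<kappa> * norm x
               + \<sigma> / (q * \<rho> powr (q - 1)) * (norm x / \<sigma> - \<rho>) powr q)
      else if \<sigma> > 0 \<and> norm x \<le> \<rho> * \<sigma> then ereal (\<alpha> * \<sigma> + \<kappa> * norm x)
      else if \<sigma> = 0 \<and> x = 0 then 0
      else \<infinity>)"
proof (cases "\<sigma> > 0")
  case True
  have n: "norm (x /\<^sub>R \<sigma>) = norm x / \<sigma>" using True by (simp add: divide_inverse_commute)
  have "\<phi> (x /\<^sub>R \<sigma>) = \<alpha> + \<kappa> * (norm x / \<sigma>)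
      + max (norm x / \<sigma> - \<rho>) 0 powr q / (q * \<rho> powr (q - 1))"
    unfolding phi_eq n ..
  moreover have "max (norm x / \<sigma> - \<rho>) 0 = (if norm x > \<rho> * \<sigma> then norm x / \<sigma> - \<rho> else 0)"
    using True by (auto simp: max_def field_simps)
  ultimately show ?thesis
    using True pos by (auto simp: perspective_def distrib_left)
next
  case False
  then show ?thesis
    by (auto simp: perspective_def recession_phi_zero recession_phi_nonzero)
qed

section \<open>The support-function inequality and the optimality certificate\<close>

text \<open>Young's inequality for \<open>m\<close> and \<open>h / \<rho>\<close>, multiplied by
  \<rho>; this rescaling produces the factor \<open>\<rho> powr (q - 1)\<close> in the definition of
  \<phi>. In use, \<open>m\<close> is the excess of a dual norm over \<kappa> and \<open>h\<close> a
  distance to the ball.\<close>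

lemma scaled_Young:
  assumes "m \<ge> 0" "h \<ge> 0"
  shows "m * h \<le> \<rho> * (m powr q' / q') + h powr q / (q * \<rho> powr (q - 1))"
proof -
  have "m * (h / \<rho>) \<le> m powr q' / q' + (h / \<rho>) powr q / q"
    using assms pos conj_exponent by (intro Youngs_inequality) auto
  then have "\<rho> * (m * (h / \<rho>)) \<le> \<rho> * (m powr q' / q' + (h / \<rho>) powr q / q)"
    using pos by (intro mult_left_mono) auto
  moreover have "\<rho> * ((h / \<rho>) powr q / q) = h powr q / (q * \<rho> powr (q - 1))"
    using assms pos by (simp add: powr_divide powr_diff mult.commute)
  ultimately show ?thesis
    using pos by (simp add: distrib_left)
qed

lemma inner_le_perspective:
  assumes "a + \<rho> * \<Delta> (norm b) \<le> \<alpha>"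
  shows "ereal (a * \<tau> + b \<bullet> y) \<le> perspective (\<lambda>y. ereal (\<phi> y)) (\<tau>, y)"
proof (cases "\<tau> > 0")
  case True
  define m where "m = max (norm b - \<kappa>) 0"
  have m: "m \<ge> 0" "norm b \<le> \<kappa> + m" by (auto simp: m_def)
  have D: "\<Delta> (norm b) = m + m powr q' / q'" by (simp add: Delta m_def)
  have "a * \<tau> \<le> (\<alpha> - \<rho> * \<Delta> (norm b)) * \<tau>"
    using assms True by (intro mult_right_mono) auto
  moreover have "b \<bullet> y \<le> (\<kappa> + m) * norm y"
    using norm_cauchy_schwarz[of b y] mult_right_mono[OF m(2), of "norm y"] by simp
  \<comment> \<open>Only the excess \<open>m * (norm y - \<tau> * \<rho>)\<close> remains to be
    absorbed. Outside the cone \<open>norm y \<le> \<rho> * \<tau>\<close> this is done by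
    \<open>scaled_Young\<close>; inside it the excess is nonpositive.\<close>
  ultimately have le: "a * \<tau> + b \<bullet> y
      \<le> \<alpha> * \<tau> + \<kappa> * norm y + (m * norm y - \<tau> * \<rho> * m) - \<tau> * (\<rho> * (m powr q' / q'))"
    by (simp add: D algebra_simps)
  show ?thesis
  proof (cases "norm y > \<rho> * \<tau>")
    case far: True
    define h where "h = norm y / \<tau> - \<rho>"
    have h: "h \<ge> 0" using far True by (simp add: h_def field_simps)
    have "m * norm y - \<tau> * \<rho> * m = \<tau> * (m * h)"
      using True by (simp add: h_def field_simps)
    also have "\<dots> \<le> \<tau> * (\<rho> * (m powr q' / q') + h powr q / (q * \<rho> powr (q - 1)))"
      using True scaled_Young[OF m(1) h] by (intro mult_left_mono) auto
    finally have "a * \<tau> + b \<bullet> y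
        \<le> \<alpha> * \<tau> + \<kappa> * norm y + \<tau> / (q * \<rho> powr (q - 1)) * h powr q"
      using le by (simp add: distrib_left)
    then show ?thesis
      using True far by (simp add: perspective_phi h_def)
  next
    case False
    have "m * norm y \<le> m * (\<rho> * \<tau>)"
      using m False by (intro mult_left_mono) auto
    moreover have "\<tau> * (\<rho> * (m powr q' / q')) \<ge> 0"
      using True pos conj_exponent by simp
    ultimately have "a * \<tau> + b \<bullet> y \<le> \<alpha> * \<tau> + \<kappa> * norm y"
      using le by (simp add: algebra_simps)
    then show ?thesis
      using True False by (simp add: perspective_phi)
  qed
next
  case False
  then show ?thesis by (simp add: perspective_phi)
qed

text \<open>The test by which every region is settled: \<open>(a, b)\<close> is the candidate for
  \<open>(z - p) / \<gamma>\<close>. Since it attains the perspective at \<open>(\<tau>, y)\<close>,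
  the constant terms of the subgradient inequality cancel and only the linear bound
  \<open>inner_le_perspective\<close> is left.\<close>

lemma prox_perspective_eqI:
  assumes g: "\<gamma> > 0"
    and feas: "a + \<rho> * \<Delta> (norm b) \<le> \<alpha>"
    and eq: "perspective (\<lambda>y. ereal (\<phi> y)) (\<tau>, y) = ereal (a * \<tau> + b \<bullet> y)"
    and z: "\<sigma> = \<tau> + \<gamma> * a" "x = y + \<gamma> *\<^sub>R b"
  shows "(\<exists>!w. prox_minimizer (\<lambda>w. ereal \<gamma> * perspective (\<lambda>y. ereal (\<phi> y)) w) (\<sigma>, x) w)
      \<and> prox (\<lambda>w. ereal \<gamma> * perspective (\<lambda>y. ereal (\<phi> y)) w) (\<sigma>, x) = (\<tau>, y)"
proof (rule prox_eqI_subgradient)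
  show "ereal \<gamma> * perspective (\<lambda>y. ereal (\<phi> y)) (\<tau>, y) = ereal (\<gamma> * (a * \<tau> + b \<bullet> y))"
    by (simp add: eq)
next
  fix w :: "real \<times> 'a"
  obtain s v where w: "w = (s, v)" by (cases w)
  have "\<gamma> * (a * \<tau> + b \<bullet> y) + ((\<sigma>, x) - (\<tau>, y)) \<bullet> (w - (\<tau>, y)) = \<gamma> * (a * s + b \<bullet> v)"
    by (simp add: w z inner_Pair inner_diff_right algebra_simps)
  then show "ereal (\<gamma> * (a * \<tau> + b \<bullet> y) + ((\<sigma>, x) - (\<tau>, y)) \<bullet> (w - (\<tau>, y)))
      \<le> ereal \<gamma> * perspective (\<lambda>y. ereal (\<phi> y)) w"
    using ereal_mult_left_mono[OF inner_le_perspective[OF feas, of s v], of "ereal \<gamma>"] g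
    by (simp add: w)
qed

section \<open>The scalar equation of the power region\<close>

text \<open>With \<tau> the first component of the proposed proximal point, the equation reads
  \<open>norm x - \<gamma> * t = \<rho> * \<tau> * (1 + (t - \<kappa>) powr (q' - 1))\<close>. It
  prescribes the norm of the second component.\<close>

definition is_root :: "real \<Rightarrow> real \<Rightarrow> 'a \<Rightarrow> real \<Rightarrow> bool" where
  "is_root \<gamma> \<sigma> x t \<longleftrightarrow> t > \<kappa> \<and>
     \<rho> * (\<sigma> - \<gamma> * \<alpha> + \<gamma> * \<rho> * (t - \<kappa> + (t - \<kappa>) powr q' / q'))
       * (1 + (t - \<kappa>) powr (q' - 1)) + \<gamma> * t - norm x = 0"

text \<open>If the first factor were nonpositive at a root, then \<open>t \<ge> \<parallel>x\<parallel> / \<gamma>\<close>, and monotonicity of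
  \<open>\<Delta>\<close> would contradict the hypothesis.\<close>
lemma root_factor_pos:
  assumes g: "\<gamma> > 0" and D: "\<Delta> (norm x / \<gamma>) > (\<alpha> - \<sigma> / \<gamma>) / \<rho>"
    and t: "is_root \<gamma> \<sigma> x t"
  shows "\<sigma> - \<gamma> * \<alpha> + \<gamma> * \<rho> * \<Delta> t > 0"
proof (rule ccontr)
  assume "\<not> ?thesis"
  then have A: "\<sigma> - \<gamma> * \<alpha> + \<gamma> * \<rho> * \<Delta> t \<le> 0" by simp
  have tk: "t > \<kappa>" and eq: "\<rho> * (\<sigma> - \<gamma> * \<alpha> + \<gamma> * \<rho> * \<Delta> t) * (1 + (t - \<kappa>) powr (q' - 1))
      + \<gamma> * t - norm x = 0"
    using t by (auto simp: is_root_def Delta_above)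
  have "\<rho> * (\<sigma> - \<gamma> * \<alpha> + \<gamma> * \<rho> * \<Delta> t) * (1 + (t - \<kappa>) powr (q' - 1)) \<le> 0"
    using pos A by (intro mult_nonpos_nonneg mult_nonneg_nonpos) auto
  then have "norm x \<le> \<gamma> * t" using eq by linarith
  then have "norm x / \<gamma> \<le> t" using g by (simp add: field_simps)
  then have "\<Delta> (norm x / \<gamma>) \<le> \<Delta> t"
    using g by (intro Delta_mono) simp
  then have "\<gamma> * \<rho> * \<Delta> (norm x / \<gamma>) \<le> \<gamma> * \<rho> * \<Delta> t"
    using g pos by (intro mult_left_mono) auto
  moreover have "\<gamma> * \<rho> * \<Delta> (norm x / \<gamma>) > \<gamma> * \<alpha> - \<sigma>"
    using D g pos by (simp add: field_simps)
  ultimately show False using A by linarith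
qed

text \<open>The left side need not be monotone while its first factor is negative, but at a root
  that factor is positive. From the smaller root on, both factors are positive and nondecreasing,
  and \<open>\<gamma> * t\<close> is strictly increasing.\<close>

lemma root_unique:
  assumes g: "\<gamma> > 0" and D: "\<Delta> (norm x / \<gamma>) > (\<alpha> - \<sigma> / \<gamma>) / \<rho>"
    and s: "is_root \<gamma> \<sigma> x s" and t: "is_root \<gamma> \<sigma> x t"
  shows "s = t"
proof -
  have False if s: "is_root \<gamma> \<sigma> x s" and t: "is_root \<gamma> \<sigma> x t" and "s < t" for s t
  proof -
    let ?A = "\<lambda>t. \<sigma> - \<gamma> * \<alpha> + \<gamma> * \<rho> * \<Delta> t" and ?B = "\<lambda>t. 1 + (t - \<kappa>) powr (q' - 1)"
    have k: "s > \<kappa>" "t > \<kappa>" using s t by (auto simp: is_root_def)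
    have eq: "\<rho> * ?A s * ?B s + \<gamma> * s = norm x" "\<rho> * ?A t * ?B t + \<gamma> * t = norm x"
      using s t k by (auto simp: is_root_def Delta_above)
    have "?A s > 0" using root_factor_pos[OF g D s] .
    moreover have "?A s \<le> ?A t"
      using g pos k \<open>s < t\<close> by (intro add_left_mono mult_left_mono Delta_mono) auto
    moreover have "?B s \<le> ?B t"
      using k \<open>s < t\<close> conj_exponent by (intro add_left_mono powr_mono2) auto
    ultimately have "\<rho> * ?A s * ?B s \<le> \<rho> * ?A t * ?B t"
      using pos by (intro mult_mono) auto
    moreover have "\<gamma> * s < \<gamma> * t" using g \<open>s < t\<close> by simp
    ultimately show False using eq by linarith
  qed
  then show ?thesis using s t by (meson linorder_less_linear)
qed

lemma root_exists:
  assumes g: "\<gamma> > 0" and x: "norm x > \<gamma> * \<kappa> + \<rho> * (\<sigma> - \<gamma> * \<alpha>)"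
  shows "\<exists>t. is_root \<gamma> \<sigma> x t"
proof -
  define F where "F = (\<lambda>t. \<rho> * (\<sigma> - \<gamma> * \<alpha> + \<gamma> * \<rho> * (t - \<kappa> + (t - \<kappa>) powr q' / q'))
       * (1 + (t - \<kappa>) powr (q' - 1)) + \<gamma> * t - norm x)"
  \<comment> \<open>The second summand makes the first factor of \<open>F\<close> nonnegative at
    \<open>u\<close>, and the third gives \<open>norm x \<le> \<gamma> * u\<close>; hence
    \<open>F u \<ge> 0\<close>.\<close>
  define u where "u = \<kappa> + \<bar>\<sigma> - \<gamma> * \<alpha>\<bar> / (\<gamma> * \<rho>) + norm x / \<gamma>"
  have gr: "\<gamma> * \<rho> > 0" using g pos by simp
  have uk: "u \<ge> \<kappa>" using g gr by (simp add: u_def)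
  \<comment> \<open>Both powers have base 0 at \<kappa> and vanish, so the hypothesis on
    \<open>norm x\<close> is exactly this inequality.\<close>
  have Fk: "F \<kappa> < 0" using x by (simp add: F_def algebra_simps)
  have Fu: "F u \<ge> 0"
  proof -
    have "\<bar>\<sigma> - \<gamma> * \<alpha>\<bar> / (\<gamma> * \<rho>) \<le> u - \<kappa> + (u - \<kappa>) powr q' / q'"
    proof -
      have "\<bar>\<sigma> - \<gamma> * \<alpha>\<bar> / (\<gamma> * \<rho>) \<le> u - \<kappa>" using g by (simp add: u_def)
      moreover have "(u - \<kappa>) powr q' / q' \<ge> 0" using conj_exponent by simp
      ultimately show ?thesis by linarith
    qed
    then have "\<gamma> * \<rho> * (\<bar>\<sigma> - \<gamma> * \<alpha>\<bar> / (\<gamma> * \<rho>)) \<le> \<gamma> * \<rho> * (u - \<kappa> + (u - \<kappa>) powr q' / q')"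
      using gr by (intro mult_left_mono) auto
    then have "0 \<le> \<sigma> - \<gamma> * \<alpha> + \<gamma> * \<rho> * (u - \<kappa> + (u - \<kappa>) powr q' / q')"
      using g pos by simp
    then have "0 \<le> \<rho> * (\<sigma> - \<gamma> * \<alpha> + \<gamma> * \<rho> * (u - \<kappa> + (u - \<kappa>) powr q' / q'))
       * (1 + (u - \<kappa>) powr (q' - 1))"
      using pos by (intro mult_nonneg_nonneg) auto
    moreover have "norm x \<le> \<gamma> * u"
    proof -
      have "norm x / \<gamma> \<le> u" using gr pos by (simp add: u_def)
      then show ?thesis using g by (simp add: field_simps)
    qed
    ultimately show ?thesis by (simp add: F_def)
  qed
  have "continuous_on {\<kappa>..u} F"
    unfolding F_def using conj_exponent
    by (intro continuous_intros continuous_on_powr') auto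
  then obtain t where t: "\<kappa> \<le> t" "F t = 0"
    using IVT'[of F \<kappa> 0 u] Fk Fu uk by auto
  with Fk have "t > \<kappa>" by (cases "t = \<kappa>") auto
  with t show ?thesis by (auto simp: is_root_def F_def)
qed

section \<open>Proximal points in the four regions\<close>

abbreviation scaled_perspective :: "real \<Rightarrow> real \<times> 'a \<Rightarrow> ereal" where
  "scaled_perspective \<gamma> \<equiv> (\<lambda>w. ereal \<gamma> * perspective (\<lambda>y. ereal (\<phi> y)) w)"

text \<open>The certificate is \<open>z / \<gamma>\<close> itself: the hypothesis says that it lies
  in the dual set, and attainment at the origin is trivial.\<close>

lemma prox_vertex:
  assumes "\<gamma> > 0" "\<Delta> (norm x / \<gamma>) \<le> (\<alpha> - \<sigma> / \<gamma>) / \<rho>"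
  shows "(\<exists>!w. prox_minimizer (scaled_perspective \<gamma>) (\<sigma>, x) w) \<and> prox (scaled_perspective \<gamma>) (\<sigma>, x) = (0, 0)"
proof (rule prox_perspective_eqI[where a = "\<sigma> / \<gamma>" and b = "x /\<^sub>R \<gamma>"])
  have "norm (x /\<^sub>R \<gamma>) = norm x / \<gamma>"
    using assms by (simp add: divide_inverse_commute)
  then show "\<sigma> / \<gamma> + \<rho> * \<Delta> (norm (x /\<^sub>R \<gamma>)) \<le> \<alpha>"
    using assms pos by (simp add: field_simps)
qed (use assms in \<open>auto simp: perspective_phi\<close>)

text \<open>The certificate has \<open>norm b = t\<close> and
  \<open>a = \<alpha> - \<rho> * \<Delta> t\<close>, so it lies on the curved boundary of the dual
  set. It attains the perspective because Young's inequality holds there with equality.\<close>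

lemma prox_power_region:
  assumes g: "\<gamma> > 0" and D: "\<Delta> (norm x / \<gamma>) > (\<alpha> - \<sigma> / \<gamma>) / \<rho>"
    and x: "x \<noteq> 0" and t: "is_root \<gamma> \<sigma> x t"
  shows "(\<exists>!w. prox_minimizer (scaled_perspective \<gamma>) (\<sigma>, x) w)
      \<and> prox (scaled_perspective \<gamma>) (\<sigma>, x)
          = (\<sigma> - \<gamma> * \<alpha> + \<gamma> * \<rho> * \<Delta> t, x - \<gamma> *\<^sub>R (t / norm x) *\<^sub>R x)"
proof -
  define s where "s = t - \<kappa>"
  define \<tau> where "\<tau> = \<sigma> - \<gamma> * \<alpha> + \<gamma> * \<rho> * \<Delta> t"
  define r where "r = \<rho> * \<tau> * (1 + s powr (q' - 1))"
  define y where "y = x - \<gamma> *\<^sub>R (t / norm x) *\<^sub>R x"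
  have s: "s > 0" using t by (simp add: s_def is_root_def)
  have tpos: "t > 0" using s pos by (simp add: s_def)
  have Dt: "\<Delta> t = s + s powr q' / q'" using s by (simp add: s_def Delta_above)
  have \<tau>: "\<tau> > 0" using root_factor_pos[OF g D t] by (simp add: \<tau>_def)
  have rx: "r = norm x - \<gamma> * t"
    using t by (simp add: is_root_def r_def \<tau>_def Dt s_def)
  have ss: "s * s powr (q' - 1) = s powr q'"
    using s by (simp add: powr_mult_base)
  have y: "y = (r / norm x) *\<^sub>R x"
    using x by (simp add: y_def rx diff_divide_distrib scaleR_left_diff_distrib)
  have r: "r > \<rho> * \<tau>" using pos \<tau> s by (simp add: r_def)
  then have r0: "r > 0" using pos \<tau> by (smt (verit) mult_pos_pos)
  have ny: "norm y = r" using x r0 by (simp add: y)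
  \<comment> \<open>The distance of \<open>y /\<^sub>R \<tau>\<close> to the ball; this value is the
    equality case of \<open>scaled_Young\<close> with \<open>m = s\<close>.\<close>
  have h: "r / \<tau> - \<rho> = \<rho> * s powr (q' - 1)"
    using \<tau> by (simp add: r_def field_simps)
  have hq: "(r / \<tau> - \<rho>) powr q = \<rho> powr q * s powr q'"
    unfolding h using pos s conj_exponent(3) by (simp add: powr_mult powr_powr)
  have persp: "perspective (\<lambda>y. ereal (\<phi> y)) (\<tau>, y)
      = ereal (\<alpha> * \<tau> + \<kappa> * r + \<tau> * \<rho> * s powr q' / q)"
    using \<tau> r pos by (simp add: perspective_phi ny hq powr_diff)
  have inner: "((t / norm x) *\<^sub>R x) \<bullet> y = t * r"
    using x by (simp add: y dot_square_norm power2_eq_square)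
  \<comment> \<open>Of the term \<open>\<rho> * \<tau> * s powr q'\<close> contained in
    \<open>s * r\<close>, the conjugate takes the share \<open>1 / q'\<close>; the share
    \<open>1 / q\<close> left over is the power term of the perspective.\<close>
  have inv: "1 / q' = 1 - 1 / q" using conj_exponent(2) by linarith
  have "(\<alpha> - \<rho> * \<Delta> t) * \<tau> + t * r
      = \<alpha> * \<tau> + \<kappa> * r + (s * r - \<rho> * \<tau> * (s + s powr q' * (1 / q')))"
    by (simp add: Dt s_def algebra_simps)
  also have "s * r = \<rho> * \<tau> * (s + s powr q')"
    by (simp add: r_def algebra_simps flip: ss)
  finally have val: "(\<alpha> - \<rho> * \<Delta> t) * \<tau> + t * r = \<alpha> * \<tau> + \<kappa> * r + \<tau> * \<rho> * s powr q' / q"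
    unfolding inv by (simp add: algebra_simps)
  show ?thesis
    unfolding \<tau>_def[symmetric] y_def[symmetric]
  proof (rule prox_perspective_eqI[OF g, where a = "\<alpha> - \<rho> * \<Delta> t" and b = "(t / norm x) *\<^sub>R x"])
    show "\<alpha> - \<rho> * \<Delta> t + \<rho> * \<Delta> (norm ((t / norm x) *\<^sub>R x)) \<le> \<alpha>"
      using x tpos by simp
    show "perspective (\<lambda>y. ereal (\<phi> y)) (\<tau>, y)
        = ereal ((\<alpha> - \<rho> * \<Delta> t) * \<tau> + ((t / norm x) *\<^sub>R x) \<bullet> y)"
      by (simp only: persp inner val)
    show "\<sigma> = \<tau> + \<gamma> * (\<alpha> - \<rho> * \<Delta> t)" by (simp add: \<tau>_def algebra_simps)
    show "x = y + \<gamma> *\<^sub>R (t / norm x) *\<^sub>R x" by (simp add: y_def)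
  qed
qed

text \<open>The certificate is \<alpha> together with the multiple of \<open>x\<close> of norm
  \<kappa>, where \<Delta> still vanishes. The second component is soft thresholding of
  \<open>x\<close>, and the upper bound on \<open>norm x\<close> keeps the point in the cone where
  the perspective has no power term.\<close>

lemma prox_norm_region:
  assumes g: "\<gamma> > 0" and x1: "\<gamma> * \<kappa> \<le> norm x" and x2: "norm x \<le> \<gamma> * \<kappa> + \<rho> * (\<sigma> - \<gamma> * \<alpha>)"
  shows "(\<exists>!w. prox_minimizer (scaled_perspective \<gamma>) (\<sigma>, x) w)
      \<and> prox (scaled_perspective \<gamma>) (\<sigma>, x) = (\<sigma> - \<gamma> * \<alpha>, (1 - \<gamma> * \<kappa> / norm x) *\<^sub>R x)"
proof -
  define \<tau> where "\<tau> = \<sigma> - \<gamma> * \<alpha>"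
  define y where "y = (1 - \<gamma> * \<kappa> / norm x) *\<^sub>R x"
  have x: "norm x > 0" using g pos x1 by (smt (verit) mult_pos_pos)
  have y': "y = ((norm x - \<gamma> * \<kappa>) / norm x) *\<^sub>R x"
    using x by (simp add: y_def diff_divide_distrib)
  have ny: "norm y = norm x - \<gamma> * \<kappa>" using x x1 by (simp add: y')
  have le: "norm y \<le> \<rho> * \<tau>" using ny x2 by (simp add: \<tau>_def)
  then have "\<rho> * \<tau> \<ge> 0" using norm_ge_zero[of y] by linarith
  then have \<tau>: "\<tau> \<ge> 0" using pos by (simp add: zero_le_mult_iff)
  \<comment> \<open>On the boundary \<open>\<tau> = 0\<close> the cone shrinks to the origin, where
    the perspective is 0 rather than infinite.\<close>
  have y0: "y = 0" if "\<tau> = 0" using le that by simp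
  have persp: "perspective (\<lambda>y. ereal (\<phi> y)) (\<tau>, y) = ereal (\<alpha> * \<tau> + \<kappa> * norm y)"
    using \<tau> le y0 by (auto simp: perspective_phi zero_ereal_def)
  have inner: "((\<kappa> / norm x) *\<^sub>R x) \<bullet> y = \<kappa> * norm y"
    using x ny by (simp add: y' dot_square_norm power2_eq_square)
  show ?thesis
    unfolding \<tau>_def[symmetric] y_def[symmetric]
  proof (rule prox_perspective_eqI[OF g, where a = \<alpha> and b = "(\<kappa> / norm x) *\<^sub>R x"])
    show "\<alpha> + \<rho> * \<Delta> (norm ((\<kappa> / norm x) *\<^sub>R x)) \<le> \<alpha>"
      using x pos by (simp add: Delta_eq_0)
    show "perspective (\<lambda>y. ereal (\<phi> y)) (\<tau>, y) = ereal (\<alpha> * \<tau> + ((\<kappa> / norm x) *\<^sub>R x) \<bullet> y)"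
      by (simp only: persp inner)
    show "\<sigma> = \<tau> + \<gamma> * \<alpha>" by (simp add: \<tau>_def)
    show "x = y + \<gamma> *\<^sub>R (\<kappa> / norm x) *\<^sub>R x" by (simp add: y_def scaleR_left_diff_distrib)
  qed
qed

text \<open>Here \<open>x /\<^sub>R \<gamma>\<close> has norm below \<kappa>, so it can serve whole
  as the dual vector and nothing of \<open>x\<close> remains in the proximal point.\<close>

lemma prox_zero_region:
  assumes g: "\<gamma> > 0" and "\<sigma> > \<gamma> * \<alpha>" "norm x < \<gamma> * \<kappa>"
  shows "(\<exists>!w. prox_minimizer (scaled_perspective \<gamma>) (\<sigma>, x) w) \<and> prox (scaled_perspective \<gamma>) (\<sigma>, x) = (\<sigma> - \<gamma> * \<alpha>, 0)"
proof (rule prox_perspective_eqI[OF g, where a = \<alpha> and b = "x /\<^sub>R \<gamma>"])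
  have "\<bar>norm (x /\<^sub>R \<gamma>)\<bar> \<le> \<kappa>" using assms by (simp add: field_simps)
  then show "\<alpha> + \<rho> * \<Delta> (norm (x /\<^sub>R \<gamma>)) \<le> \<alpha>" by (simp add: Delta_eq_0)
  have "\<rho> * (\<sigma> - \<gamma> * \<alpha>) \<ge> 0" using assms pos by simp
  then show "perspective (\<lambda>y. ereal (\<phi> y)) (\<sigma> - \<gamma> * \<alpha>, 0)
      = ereal (\<alpha> * (\<sigma> - \<gamma> * \<alpha>) + (x /\<^sub>R \<gamma>) \<bullet> 0)"
    using assms by (simp add: perspective_phi)
qed (use g in auto)

text \<open>The four regions cover the whole space, and each region lemma supplies a unique
  minimizer, so the description in \<open>prox\<close> is meaningful everywhere.\<close>

lemma prox_unique_minimizer: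
  assumes g: "\<gamma> > 0"
  shows "\<exists>!w. prox_minimizer (scaled_perspective \<gamma>) (\<sigma>, x) w"
proof -
  consider "\<Delta> (norm x / \<gamma>) \<le> (\<alpha> - \<sigma> / \<gamma>) / \<rho>"
    | "\<gamma> * \<kappa> \<le> norm x" "norm x \<le> \<gamma> * \<kappa> + \<rho> * (\<sigma> - \<gamma> * \<alpha>)"
    | "\<Delta> (norm x / \<gamma>) > (\<alpha> - \<sigma> / \<gamma>) / \<rho>" "norm x < \<gamma> * \<kappa>"
    | "\<Delta> (norm x / \<gamma>) > (\<alpha> - \<sigma> / \<gamma>) / \<rho>" "\<gamma> * \<kappa> \<le> norm x"
      "norm x > \<gamma> * \<kappa> + \<rho> * (\<sigma> - \<gamma> * \<alpha>)"
    by linarith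
  then show ?thesis
  proof cases
    case 1
    then show ?thesis using prox_vertex[OF g] by blast
  next
    case 2
    then show ?thesis using prox_norm_region[OF g] by blast
  next
    case 3
    \<comment> \<open>Below the threshold \<kappa> the strict inequality on \<Delta> reduces to
      \<open>\<sigma> > \<gamma> * \<alpha>\<close>, the condition of the zero region.\<close>
    then have "\<Delta> (norm x / \<gamma>) = 0"
      using g by (intro Delta_eq_0) (simp add: field_simps)
    then have "\<sigma> > \<gamma> * \<alpha>" using 3(1) g pos by (simp add: field_simps)
    then show ?thesis using prox_zero_region[OF g] 3(2) by blast
  next
    case 4
    have "x \<noteq> 0" using 4(2) g pos by (auto simp: mult_le_0_iff)
    then show ?thesis
      using prox_power_region[OF g 4(1)] root_exists[OF g 4(3)] by blast
  qed
qed

end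

section \<open>Assembly of the formulas\<close>

theorem mainTheorem3:
  fixes \<alpha> \<gamma> \<rho> \<kappa> q q' \<sigma> :: real
    and C :: "'a::{real_inner, complete_space} set"
    and \<phi> :: "'a \<Rightarrow> real"
    and \<Delta> :: "real \<Rightarrow> real"
    and x :: 'a
  assumes "\<alpha> > 0" and "\<gamma> > 0" and "\<rho> > 0" and "\<kappa> > 0" and "q > 1"
    and "q' = q / (q - 1)"
    and "C = {y. norm y \<le> \<rho>}"
    and "\<phi> = (\<lambda>y. \<alpha> + \<kappa> * norm y + infdist y C powr q / (q * \<rho> powr (q - 1)))"
    and "\<Delta> = (\<lambda>\<mu>. max (\<bar>\<mu>\<bar> - \<kappa>) 0 + (max (\<bar>\<mu>\<bar> - \<kappa>) 0) powr q' / q')"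
  shows
    "perspective (\<lambda>y. ereal (\<phi> y)) (\<sigma>, x) =
       (if \<sigma> > 0 \<and> norm x > \<rho> * \<sigma> then
          ereal (\<alpha> * \<sigma> + \<kappa> * norm x
                 + \<sigma> / (q * \<rho> powr (q - 1)) * (norm x / \<sigma> - \<rho>) powr q)
        else if \<sigma> > 0 \<and> norm x \<le> \<rho> * \<sigma> then ereal (\<alpha> * \<sigma> + \<kappa> * norm x)
        else if \<sigma> = 0 \<and> x = 0 then 0
        else \<infinity>)
     \<and>
     (let g = (\<lambda>w. ereal \<gamma> * perspective (\<lambda>y. ereal (\<phi> y)) w) in
       (\<exists>!w. prox_minimizer g (\<sigma>, x) w)
       \<and>
       (\<Delta> (norm x / \<gamma>) \<le> (\<alpha> - \<sigma> / \<gamma>) / \<rho> \<longrightarrow> prox g (\<sigma>, x) = (0, 0))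
       \<and>
       (\<Delta> (norm x / \<gamma>) > (\<alpha> - \<sigma> / \<gamma>) / \<rho> \<and> norm x > \<gamma> * \<kappa> + \<rho> * (\<sigma> - \<gamma> * \<alpha>) \<longrightarrow>
         (let solution = (\<lambda>t. t > \<kappa> \<and>
                \<rho> * (\<sigma> - \<gamma> * \<alpha> + \<gamma> * \<rho> * (t - \<kappa> + (t - \<kappa>) powr q' / q'))
                  * (1 + (t - \<kappa>) powr (q' - 1)) + \<gamma> * t - norm x = 0) in
           (x \<noteq> 0 \<longrightarrow> (\<exists>!t. solution t))
           \<and>
           (\<forall>t p. (x \<noteq> 0 \<longrightarrow> solution t \<and> p = (t / norm x) *\<^sub>R x)
                  \<and> (x = 0 \<longrightarrow> t = 0 \<and> p = 0)
              \<longrightarrow> prox g (\<sigma>, x) = (\<sigma> - \<gamma> * \<alpha> + \<gamma> * \<rho> * \<Delta> t, x - \<gamma> *\<^sub>R p))))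
       \<and>
       (\<gamma> * \<kappa> \<le> norm x \<and> norm x \<le> \<gamma> * \<kappa> + \<rho> * (\<sigma> - \<gamma> * \<alpha>) \<longrightarrow>
          prox g (\<sigma>, x) = (\<sigma> - \<gamma> * \<alpha>, (1 - \<gamma> * \<kappa> / norm x) *\<^sub>R x))
       \<and>
       (\<sigma> > \<gamma> * \<alpha> \<and> norm x < \<gamma> * \<kappa> \<longrightarrow> prox g (\<sigma>, x) = (\<sigma> - \<gamma> * \<alpha>, 0)))"
proof -
  interpret ball_distance_perspective \<alpha> \<rho> \<kappa> q q' \<phi> \<Delta>
    using assms by unfold_locales auto
  note g = \<open>\<gamma> > 0\<close>
  \<comment> \<open>The two conditions of case (ii) exclude \<open>x = 0\<close>: as \<Delta>
    vanishes at 0, the first gives \<open>\<sigma> > \<gamma> * \<alpha>\<close>, and then the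
    second would put 0 above a positive number.\<close>
  have x0: "x \<noteq> 0" if "\<Delta> (norm x / \<gamma>) > (\<alpha> - \<sigma> / \<gamma>) / \<rho>"
    "norm x > \<gamma> * \<kappa> + \<rho> * (\<sigma> - \<gamma> * \<alpha>)"
  proof
    assume "x = 0"
    with that pos have "(\<alpha> - \<sigma> / \<gamma>) / \<rho> < 0" "0 > \<gamma> * \<kappa> + \<rho> * (\<sigma> - \<gamma> * \<alpha>)"
      by (auto simp: Delta_eq_0)
    then have "\<sigma> - \<gamma> * \<alpha> > 0" using g pos by (simp add: field_simps)
    then have "\<gamma> * \<kappa> + \<rho> * (\<sigma> - \<gamma> * \<alpha>) > 0"
      using g pos by (intro add_pos_pos mult_pos_pos) auto
    then show False using \<open>0 > \<gamma> * \<kappa> + \<rho> * (\<sigma> - \<gamma> * \<alpha>)\<close> by simp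
  qed
  have ex1: "\<exists>!t. is_root \<gamma> \<sigma> x t" if "\<Delta> (norm x / \<gamma>) > (\<alpha> - \<sigma> / \<gamma>) / \<rho>"
    "norm x > \<gamma> * \<kappa> + \<rho> * (\<sigma> - \<gamma> * \<alpha>)"
    using root_exists[OF g that(2)] root_unique[OF g that(1)] by blast
  show ?thesis
    \<comment> \<open>Once the \<open>let\<close> is expanded, the bound predicate
      \<open>solution\<close> is literally the body of \<open>is_root\<close>.\<close>
    unfolding Let_def is_root_def[symmetric]
  proof (intro conjI impI allI; (elim conjE)?)
    fix t p
    assume D: "\<Delta> (norm x / \<gamma>) > (\<alpha> - \<sigma> / \<gamma>) / \<rho>"
      and n: "norm x > \<gamma> * \<kappa> + \<rho> * (\<sigma> - \<gamma> * \<alpha>)"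
      and tp: "x \<noteq> 0 \<longrightarrow> is_root \<gamma> \<sigma> x t \<and> p = (t / norm x) *\<^sub>R x"
    show "prox (scaled_perspective \<gamma>) (\<sigma>, x) = (\<sigma> - \<gamma> * \<alpha> + \<gamma> * \<rho> * \<Delta> t, x - \<gamma> *\<^sub>R p)"
      using prox_power_region[OF g D x0[OF D n]] tp x0[OF D n] by simp
  qed (assumption | rule perspective_phi prox_unique_minimizer[OF g] ex1
      conjunct2[OF prox_vertex[OF g]] conjunct2[OF prox_norm_region[OF g]]
      conjunct2[OF prox_zero_region[OF g]])+
qed

end
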